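(* Let $A\in\mathbb{R}^{n\times n}$ be an $M$-matrix with property $c$ and let $A=K-L=U-V=X-Y$ be three regular splittings of $A$ such that $K+X-A+YU^{-1}L$ is nonsingular. Let $b\in\mathbb{R}^n$ be such that $Ax=b$ is consistent, and put $\mathcal{H}=X^{-1}YU^{-1}VK^{-1}L$ and $\hat b=X^{-1}(YU^{-1}VK^{-1}+YU^{-1}+I)b$. Then: (i) if all diagonal entries of $\mathcal{H}$ are positive, then the three-step alternating scheme $x^{k+1}=\mathcal{H}x^k+\hat b$, $k=0,1,2,\ldots$, converges to a solution of $Ax=b$ for any initial vector $x^0\in\mathbb{R}^n$; (ii) for every $\delta\in(0,1)$, the modified three-step alternating scheme $x^{k+1}=\delta(\mathcal{H}x^k+\hat b)+(1-\delta)x^k$, $k=0,1,2,\ldots$, converges to a solution of $Ax=b$ for any initial vector $x^0\in\mathbb{R}^n$.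
   Context: Matrices are real $n\times n$; $\rho$ is the spectral radius; $B\ge 0$ means entrywise nonnegative. A matrix $T$ is semiconvergent if $\lim_{k\to\infty}T^k$ exists (not necessarily zero). $A$ is an $M$-matrix if $A=sI-B$ with $B\ge 0$, $s>0$ and $s\ge\rho(B)$; it has property $c$ if $s^{-1}B$ is semiconvergent for some such representation $A=sI-B$. A splitting $A=U-V$ is an expression with $U$ nonsingular; it is regular if $U^{-1}\ge 0$ and $V\ge 0$. *)

theory Defs
  imports "HOL-Analysis.Analysis"
begin

text \<open>
  The library orders \<open>real^'n^'n\<close> componentwise, so \<open>0 \<le> M\<close> says that \<open>M\<close> is entrywise nonnegative.
\<close>

definition complex_eigenvalue :: "real^'n^'n \<Rightarrow> complex \<Rightarrow> bool" where
  "complex_eigenvalue M z \<longleftrightarrow>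
     (\<exists>v :: complex^'n. v \<noteq> 0 \<and> map_matrix complex_of_real M *v v = z *s v)"

definition spectral_radius :: "real^'n^'n \<Rightarrow> real" where
  "spectral_radius M = Max (cmod ` {z. complex_eigenvalue M z})"

text \<open>
  Powers with respect to the matrix product \<open>**\<close>; the library operations \<open>*\<close> and \<open>^\<close> on vectors
  and matrices, where available, are componentwise.
\<close>

primrec matrix_power :: "real^'n^'n \<Rightarrow> nat \<Rightarrow> real^'n^'n" where
  "matrix_power M 0 = mat 1"
| "matrix_power M (Suc k) = M ** matrix_power M k"

definition semiconvergent :: "real^'n^'n \<Rightarrow> bool" where
  "semiconvergent T \<longleftrightarrow> convergent (\<lambda>k. matrix_power T k)"

definition M_matrix_representation :: "real^'n^'n \<Rightarrow> real \<Rightarrow> real^'n^'n \<Rightarrow> bool" where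
  "M_matrix_representation A s B \<longleftrightarrow>
     A = s *\<^sub>R mat 1 - B \<and> 0 \<le> B \<and> 0 < s \<and> spectral_radius B \<le> s"

definition M_matrix :: "real^'n^'n \<Rightarrow> bool" where
  "M_matrix A \<longleftrightarrow> (\<exists>s B. M_matrix_representation A s B)"

definition property_c :: "real^'n^'n \<Rightarrow> bool" where
  "property_c A \<longleftrightarrow> (\<exists>s B. M_matrix_representation A s B \<and> semiconvergent (inverse s *\<^sub>R B))"

definition regular_splitting :: "real^'n^'n \<Rightarrow> real^'n^'n \<Rightarrow> real^'n^'n \<Rightarrow> bool" where
  "regular_splitting A U V \<longleftrightarrow>
     A = U - V \<and> invertible U \<and> 0 \<le> matrix_inv U \<and> 0 \<le> V"

end

theory Submission
  imports Defs "HOL-Computational_Algebra.Fundamental_Theorem_Algebra"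
begin

text \<open>
  With \<open>G = X\<^sup>-\<^sup>1 (Y U\<^sup>-\<^sup>1 V K\<^sup>-\<^sup>1 + Y U\<^sup>-\<^sup>1 + I)\<close> one has \<open>G \<ge> 0\<close>, \<open>I - G A = H \<ge> 0\<close> and, crucially, also
  \<open>I - A G = Y X\<^sup>-\<^sup>1 V U\<^sup>-\<^sup>1 L K\<^sup>-\<^sup>1 \<ge> 0\<close>; the extra hypothesis makes \<open>G\<close> invertible, so that the fixed
  points of the scheme are the solutions of \<open>A x = b\<close>.  Property c yields \<open>P = lim T\<^sup>k \<ge> 0\<close> and a matrix
  \<open>C \<ge> 0\<close> with \<open>A C = C A = I - P\<close>.  Playing these signs against each other bounds the partial sums of
  \<open>H\<^sup>k G\<close> linearly.  A nonnegative matrix with positive diagonal and linearly bounded sums of powers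
  has no eigenvalue outside the open unit disc other than 1, and 1 is semisimple; hence its powers
  converge.  The damped scheme is the same situation with \<open>\<delta> G\<close> in place of \<open>G\<close>.
\<close>

subsection \<open>Complex matrices with exponentially convergent iterates\<close>

lemma norm_vector_scalar_mult:
  fixes x :: "complex^'n"
  shows "norm (c *s x) = cmod c * norm x"
  by (simp add: norm_vec_def norm_mult L2_set_right_distrib)

lemma funpow_mv_diff: "(((*v) M) ^^ k) (x - y) = (((*v) M) ^^ k) x - (((*v) M) ^^ k) y"
  for M :: "('a::ring_1)^'n^'n"
  by (induction k) (simp_all add: matrix_vector_mult_diff_distrib)

lemma funpow_mv_scale: "(((*v) M) ^^ k) (c *s x) = c *s (((*v) M) ^^ k) x"
  for M :: "('a::field)^'n^'n"
  by (induction k) (simp_all add: vector_scalar_commute)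

lemma funpow_mv_fixed: "M *v l = l \<Longrightarrow> (((*v) M) ^^ k) l = l"
  by (induction k) simp_all

text \<open>A geometric rate is required, and not mere convergence to 0, because the series that
  inverts \<open>M - z I\<close> for \<open>cmod z = 1\<close> needs summable iterates.\<close>

definition decays :: "complex^'n^'n \<Rightarrow> complex^'n \<Rightarrow> bool" where
  "decays M z \<longleftrightarrow> (\<exists>c q. 0 < q \<and> q < 1 \<and> (\<forall>m. norm ((((*v) M) ^^ m) z) \<le> c * q ^ m))"

definition settles :: "complex^'n^'n \<Rightarrow> complex^'n \<Rightarrow> bool" where
  "settles M x \<longleftrightarrow> (\<exists>l. M *v l = l \<and> decays M (x - l))"

text \<open>Since \<open>M^(m+1) x = M^m (M x - z x) + z M^m x\<close>, the norms obey a scalar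
  recursion with factor \<open>cmod z < 1\<close> and geometrically small forcing.\<close>

lemma decays_step_inside:
  assumes y: "decays M (M *v x - z *s x)" and z: "cmod z < 1"
  shows "decays M x"
proof -
  from y obtain c q where q: "0 < q" "q < 1"
    and cq: "\<And>m. norm ((((*v) M) ^^ m) (M *v x - z *s x)) \<le> c * q ^ m"
    unfolding decays_def by auto
  have c0: "0 \<le> c" using order_trans[OF norm_ge_zero cq[of 0]] by simp
  \<comment> \<open>The midpoint lies strictly between \<open>max q (cmod z)\<close> and 1. Then
    \<open>d\<close> is the least constant with \<open>norm x <= d\<close> for the base case and
    \<open>c + cmod z * d <= d * r\<close> for the induction step.\<close>
  define r where "r = (max q (cmod z) + 1) / 2"
  have r: "q \<le> r" "cmod z < r" "0 < r" "r < 1" using q z by (auto simp: r_def max_def)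
  define d where "d = max (norm x) (c / (r - cmod z))"
  have d: "norm x \<le> d" "c \<le> d * (r - cmod z)"
    using r by (auto simp: d_def max_def pos_divide_le_eq pos_le_divide_eq not_le)
  have "norm ((((*v) M) ^^ m) x) \<le> d * r ^ m" for m
  proof (induction m)
    case (Suc m)
    have "(((*v) M) ^^ Suc m) x = (((*v) M) ^^ m) (M *v x - z *s x) + z *s (((*v) M) ^^ m) x"
      by (simp add: funpow_mv_diff funpow_mv_scale funpow_swap1)
    then have "norm ((((*v) M) ^^ Suc m) x) \<le> c * q ^ m + cmod z * norm ((((*v) M) ^^ m) x)"
      using norm_triangle_ineq cq[of m] norm_vector_scalar_mult[of z]
      by (smt (verit, best))
    also have "\<dots> \<le> c * r ^ m + cmod z * (d * r ^ m)"
      using c0 r q Suc by (intro add_mono mult_left_mono power_mono) auto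
    also have "\<dots> = (c + cmod z * d) * r ^ m" by (simp add: algebra_simps)
    also have "\<dots> \<le> (d * r) * r ^ m"
      using d r by (intro mult_right_mono) (auto simp: algebra_simps)
    finally show ?case by (simp add: algebra_simps)
  qed (use d in simp)
  with r show ?thesis unfolding decays_def by blast
qed

text \<open>The preimage is the Neumann series \<open>e = - (\<Sum>j. z\<^sup>-\<^sup>j\<^sup>-\<^sup>1 M\<^sup>j d)\<close>.\<close>

lemma decays_range_outside:
  fixes M :: "complex^'n^'n"
  assumes d: "decays M d" and z: "1 \<le> cmod z"
  obtains e where "decays M e" "M *v e - z *s e = d"
proof -
  from d obtain c q where q: "0 < q" "q < 1"
    and cq: "\<And>m. norm ((((*v) M) ^^ m) d) \<le> c * q ^ m"
    unfolding decays_def by auto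
  have c0: "0 \<le> c" using order_trans[OF norm_ge_zero cq[of 0]] by simp
  have z0: "z \<noteq> 0" using z by auto
  define w where "w = inverse z"
  have w: "cmod w \<le> 1" "w * z = 1" using z z0 by (auto simp: w_def norm_inverse inverse_le_1_iff)
  define t where "t j = w ^ Suc j *s (((*v) M) ^^ j) d" for j
  have w1: "cmod (w ^ Suc j) \<le> 1" for j
    using w(1) unfolding norm_power by (intro power_le_one) auto
  have tm: "norm ((((*v) M) ^^ m) (t j)) \<le> c * q ^ m * q ^ j" for m j
  proof -
    have "(((*v) M) ^^ m) (t j) = w ^ Suc j *s (((*v) M) ^^ (m + j)) d"
      unfolding t_def by (simp only: funpow_mv_scale funpow_add o_def)
    then have "norm ((((*v) M) ^^ m) (t j)) \<le> 1 * norm ((((*v) M) ^^ (m + j)) d)"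
      using w1[of j] by (simp only: norm_vector_scalar_mult) (intro mult_right_mono, auto)
    with cq[of "m+j"] show ?thesis by (simp add: power_add algebra_simps)
  qed
  have sg: "summable (\<lambda>j. c * q ^ m * q ^ j)" for m
    using q by (intro summable_mult summable_geometric) auto
  have st: "summable t"
    by (rule summable_comparison_test[OF _ sg[of 0]]) (use tm[of 0] in auto)
  define e where "e = - suminf t"
  have bl: "bounded_linear (((*v) M) ^^ m)" for m
    unfolding linear_conv_bounded_linear[symmetric]
    by (induction m) (auto intro: linear_compose[unfolded o_def] linear_ident simp: id_def)
  have em: "norm ((((*v) M) ^^ m) e) \<le> c / (1 - q) * q ^ m" for m
  proof -
    have "(((*v) M) ^^ m) e = - (\<Sum>j. (((*v) M) ^^ m) (t j))"
      unfolding e_def using bounded_linear.suminf[OF bl st, of m]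
      by (simp add: linear_neg[OF bounded_linear.linear[OF bl]])
    then have "norm ((((*v) M) ^^ m) e) \<le> (\<Sum>j. c * q ^ m * q ^ j)"
      using norm_suminf_le[OF tm sg] by simp
    also have "\<dots> = c * q ^ m * (1 / (1 - q))"
      using q by (subst suminf_mult) (auto simp: suminf_geometric summable_geometric)
    finally show ?thesis by (simp add: field_simps)
  qed
  have "decays M e" unfolding decays_def using q em by blast
  moreover have "M *v e - z *s e = d"
  proof -
    \<comment> \<open>The terms \<open>M t_j - z t_j\<close> telescope through \<open>g\<close>,
      which tends to 0, so they sum to \<open>- g 0 = - d\<close>; hence the minus sign in
      \<open>e\<close>.\<close>
    define g where "g j = w ^ j *s (((*v) M) ^^ j) d" for j
    have gt: "M *v t j - z *s t j = g (Suc j) - g j" for j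
      using w(2) by (simp add: t_def g_def vector_scalar_commute vector_smult_assoc mult.commute
          flip: mult.assoc)
    have g0: "g \<longlonglongrightarrow> 0"
    proof (rule Lim_null_comparison)
      show "\<forall>\<^sub>F j in sequentially. norm (g j) \<le> c * q ^ j"
      proof (intro always_eventually allI)
        fix j
        have "cmod (w ^ j) \<le> 1" using w(1) unfolding norm_power by (intro power_le_one) auto
        then show "norm (g j) \<le> c * q ^ j"
          unfolding g_def norm_vector_scalar_mult using cq[of j]
            mult_right_mono[of "cmod (w ^ j)" 1 "norm ((((*v) M) ^^ j) d)"] by auto
      qed
      show "(\<lambda>j. c * q ^ j) \<longlonglongrightarrow> 0"
        using q by (intro tendsto_mult_right_zero LIMSEQ_power_zero) auto
    qed
    have "(\<lambda>j. g (Suc j) - g j) sums (0 - g 0)"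
      by (rule telescope_sums[OF g0])
    then have 1: "(\<lambda>j. M *v t j - z *s t j) sums (- d)"
      by (simp add: gt g_def)
    have bz: "bounded_linear (\<lambda>x::complex^'n. M *v x - z *s x)"
      by (intro linear_conv_bounded_linear[THEN iffD1] linearI)
        (simp_all add: algebra_simps vector_add_ldistrib vec_eq_iff matrix_vector_mult_def scaleR_sum_right sum.distrib)
    have "(\<lambda>j. M *v t j - z *s t j) sums (M *v suminf t - z *s suminf t)"
      using bounded_linear.sums[OF bz summable_sums[OF st]] .
    with 1 have "M *v suminf t - z *s suminf t = - d" by (rule sums_unique2[symmetric])
    then show ?thesis
      using linear_neg[OF bounded_linear.linear[OF bz], of "suminf t"] by (simp add: e_def)
  qed
  ultimately show ?thesis by (rule that)
qed

text \<open>\<open>M x - z x\<close> is a fixed vector \<open>l\<close> plus a decaying part. For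
  \<open>z = 1\<close>, subtracting a preimage of the decaying part from \<open>x\<close> leaves a
  Jordan chain ending in \<open>l\<close>, which \<open>index\<close> collapses. For other
  \<open>z\<close> a fixed vector absorbs \<open>l\<close>, and the rest of \<open>x\<close> decays,
  by contraction inside the disc and by \<open>peripheral\<close> outside.\<close>

lemma settles_step:
  fixes M :: "complex^'n^'n"
  assumes peripheral: "\<And>z u. 1 \<le> cmod z \<Longrightarrow> M *v u = z *s u \<Longrightarrow> z = 1 \<or> u = 0"
    and index: "\<And>x y. M *v y = y \<Longrightarrow> M *v x = x + y \<Longrightarrow> y = 0"
    and y: "settles M (M *v x - z *s x)"
  shows "settles M x"
proof -
  from y obtain l where l: "M *v l = l" and dl: "decays M (M *v x - z *s x - l)"
    unfolding settles_def by auto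
  show ?thesis
  proof (cases "z = 1")
    case True
    obtain e where e: "decays M e" "M *v e - z *s e = M *v x - z *s x - l"
      using decays_range_outside[OF dl, of z] True by auto
    have "M *v (x - e) = (x - e) + l"
      using e(2) True by (simp add: matrix_vector_mult_diff_distrib algebra_simps)
    with index[OF l, of "x - e"] have "M *v (x - e) = x - e" by auto
    then show ?thesis unfolding settles_def using e(1) by (intro exI[of _ "x - e"]) auto
  next
    case False
    \<comment> \<open>\<open>k\<close> is the fixed vector with \<open>M k - z k = l\<close>, so the
      residual of \<open>x - k\<close> is the decaying part alone.\<close>
    define k where "k = inverse (1 - z) *s l"
    have Mk: "M *v k = k" by (simp add: k_def vector_scalar_commute l)
    have "(1 - z) *s k = l" using False by (simp add: k_def vector_smult_assoc)
    then have kl: "k - z *s k = l" by (simp add: vector_sub_rdistrib)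
    have eq: "M *v (x - k) - z *s (x - k) = M *v x - z *s x - l"
      using kl[symmetric] by (simp add: matrix_vector_mult_diff_distrib Mk vector_ssub_ldistrib)
    have "decays M (x - k)"
    proof (cases "cmod z < 1")
      case True
      show ?thesis by (rule decays_step_inside[OF _ True]) (simp only: eq dl)
    next
      case out: False
      obtain e where e: "decays M e" "M *v e - z *s e = M *v x - z *s x - l"
        using decays_range_outside[OF dl, of z] out by auto
      have "M *v (x - k - e) = z *s (x - k - e)"
        using e(2) unfolding eq[symmetric]
        by (simp add: matrix_vector_mult_diff_distrib vector_ssub_ldistrib algebra_simps)
      then have "x - k - e = 0" using peripheral[of z "x - k - e"] out False by auto
      then show ?thesis using e(1) by simp
    qed
    with Mk show ?thesis unfolding settles_def by blast
  qed
qed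

text \<open>The \<open>CARD('n) + 1\<close> vectors \<open>x, M x, M^2 x, ...\<close> satisfy a
  nontrivial linear relation, whose coefficients become those of \<open>p\<close>.\<close>

lemma annihilating_poly:
  fixes M :: "complex^'n^'n" and x :: "complex^'n"
  obtains p :: "complex poly" where "p \<noteq> 0"
    "(\<Sum>k\<le>degree p. coeff p k *s (((*v) M) ^^ k) x) = 0"
proof -
  define v where "v k = (((*v) M) ^^ k) x" for k
  define N where "N = CARD('n)"
  have "\<exists>c. (\<exists>k\<le>N. c k \<noteq> 0) \<and> (\<Sum>k\<le>N. c k *s v k) = 0"
  proof (cases "inj_on v {..N}")
    case True
    have "vec.dependent (v ` {..N})"
      using vec.dim_subset_UNIV[of "v ` {..N}"]
      by (intro vec.dependent_biggerset_general)
        (simp add: card_image[OF True], simp add: N_def vec.dimension_def card_cart_basis)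
    then obtain u where u: "\<exists>a\<in>v ` {..N}. u a \<noteq> 0" "(\<Sum>a\<in>v ` {..N}. u a *s a) = 0"
      by (subst (asm) vec.dependent_finite) auto
    then show ?thesis
      by (intro exI[of _ "u \<circ> v"]) (auto simp: sum.reindex[OF True])
  next
    \<comment> \<open>Dependence is a property of the set of vectors and does not see repetitions; a
      repeated vector yields the relation \<open>v i - v j = 0\<close> directly.\<close>
    case False
    then obtain i j where ij: "i \<le> N" "j \<le> N" "i \<noteq> j" "v i = v j" by (auto simp: inj_on_def)
    have "(\<Sum>k\<le>N. ((if k = i then 1 else 0) - (if k = j then 1 else 0)) *s v k) = v i - v j"
      using ij by (simp add: vector_sub_rdistrib sum_subtractf if_distrib[of "\<lambda>c. c *s _"] sum.delta cong: if_cong)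
    with ij show ?thesis
      by (intro exI[of _ "\<lambda>k. (if k = i then 1 else 0) - (if k = j then 1 else 0)"]) auto
  qed
  then obtain c k where c: "k \<le> N" "c k \<noteq> 0" "(\<Sum>k\<le>N. c k *s v k) = 0" by auto
  define p where "p = (\<Sum>k\<le>N. monom (c k) k)"
  have cp: "coeff p j = (if j \<le> N then c j else 0)" for j
    by (simp add: p_def coeff_sum sum.delta)
  have "p \<noteq> 0" using c cp[of k] by auto
  moreover have "degree p \<le> N" by (rule degree_le) (simp add: cp)
  then have "(\<Sum>k\<le>degree p. coeff p k *s v k) = (\<Sum>k\<le>N. coeff p k *s v k)"
    by (intro sum.mono_neutral_left) (auto simp: coeff_eq_0)
  ultimately show ?thesis using that[of p] c(3) by (simp add: cp v_def)
qed

text \<open>One root of an annihilating polynomial is split off at a time, which replaces a Jordan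
  decomposition; the exponential rate in \<^const>\<open>settles\<close> is what makes the induction go through.\<close>

lemma settles_all:
  fixes M :: "complex^'n^'n"
  assumes peripheral: "\<And>z u. 1 \<le> cmod z \<Longrightarrow> M *v u = z *s u \<Longrightarrow> z = 1 \<or> u = 0"
    and index: "\<And>x y. M *v y = y \<Longrightarrow> M *v x = x + y \<Longrightarrow> y = 0"
  shows "settles M x"
proof -
  have "settles M x"
    if "p \<noteq> 0" "(\<Sum>k\<le>degree p. coeff p k *s (((*v) M) ^^ k) x) = 0"
    for x and p :: "complex poly"
    using that
  proof (induction "degree p" arbitrary: p x)
    case 0
    then have "coeff p 0 \<noteq> 0" by (metis leading_coeff_neq_0)
    with 0 have "x = 0" by simp
    then show ?case unfolding settles_def decays_def
      by (intro exI[of _ 0]) (auto simp: funpow_mv_fixed intro!: exI[of _ 0] exI[of _ "1/2"])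
  next
    case (Suc n)
    from Suc.hyps(2) have "\<not> constant (poly p)" by (simp add: constant_degree)
    then obtain z where "poly p z = 0" using fundamental_theorem_of_algebra by blast
    then obtain q where pq: "p = [:- z, 1:] * q" by (auto simp: poly_eq_0_iff_dvd)
    with Suc.prems have q0: "q \<noteq> 0" by auto
    have dp: "degree p = Suc (degree q)" unfolding pq using q0 by (subst degree_mult_eq) auto
    \<comment> \<open>Multiplication by the variable shifts the iterates, so the combination for
      \<open>p\<close> at \<open>x\<close> equals that for \<open>q\<close> at
      \<open>M x - z x\<close>, and the induction hypothesis applies to \<open>q\<close>.\<close>
    have p2: "p = pCons 0 q - smult z q" by (simp add: pq)
    let ?s = "\<lambda>k. (((*v) M) ^^ k)"
    have "0 = (\<Sum>k\<le>Suc (degree q). coeff p k *s ?s k x)" using Suc.prems(2) dp by simp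
    also have "\<dots> = (\<Sum>k\<le>Suc (degree q). coeff (pCons 0 q) k *s ?s k x)
        - (\<Sum>k\<le>Suc (degree q). coeff (smult z q) k *s ?s k x)"
      by (simp only: p2 coeff_diff vector_sub_rdistrib sum_subtractf)
    also have "(\<Sum>k\<le>Suc (degree q). coeff (pCons 0 q) k *s ?s k x)
        = (\<Sum>k\<le>degree q. coeff q k *s ?s k (M *v x))"
      by (subst sum.atMost_Suc_shift) (simp add: funpow_swap1)
    also have "(\<Sum>k\<le>Suc (degree q). coeff (smult z q) k *s ?s k x)
        = (\<Sum>k\<le>degree q. coeff q k *s ?s k (z *s x))"
      by (simp add: coeff_eq_0 funpow_mv_scale vector_smult_assoc mult.commute)
    finally have "(\<Sum>k\<le>degree q. coeff q k *s ?s k (M *v x - z *s x)) = 0"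
      by (simp add: funpow_mv_diff vector_ssub_ldistrib sum_subtractf)
    then have "settles M (M *v x - z *s x)"
      using Suc.hyps(1)[of q] Suc.hyps(2) dp q0 by simp
    then show ?case using settles_step[of M x z] peripheral index by blast
  qed
  moreover obtain p :: "complex poly" where "p \<noteq> 0"
    "(\<Sum>k\<le>degree p. coeff p k *s (((*v) M) ^^ k) x) = 0"
    by (rule annihilating_poly)
  ultimately show ?thesis by blast
qed

subsection \<open>Linear bounds from property c\<close>

lemma matrix_nonneg_iff: "0 \<le> (M :: real^'m^'n) \<longleftrightarrow> (\<forall>i j. 0 \<le> M $ i $ j)"
  by (simp add: less_eq_vec_def)

lemma matrix_mul_nonneg:
  fixes M :: "real^'m^'n" and N :: "real^'k^'m"
  shows "0 \<le> M \<Longrightarrow> 0 \<le> N \<Longrightarrow> 0 \<le> M ** N"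
  by (auto simp: matrix_nonneg_iff matrix_matrix_mult_def intro!: sum_nonneg)

lemma mat_1_nonneg: "0 \<le> (mat 1 :: real^'n^'n)"
  by (simp add: matrix_nonneg_iff mat_def)

lemma matrix_distribs:
  fixes M N :: "real^'m^'n" and R S :: "real^'k^'m"
  shows "M ** (R + S) = M ** R + M ** S" "(M + N) ** R = M ** R + N ** R"
    "M ** (R - S) = M ** R - M ** S" "(M - N) ** R = M ** R - N ** R"
  by (simp_all add: vec_eq_iff matrix_matrix_mult_def algebra_simps sum.distrib sum_subtractf)

lemma matrix_mul_le_left:
  fixes M N :: "real^'m^'n" and R :: "real^'n^'k"
  assumes "0 \<le> R" "M \<le> N"
  shows "R ** M \<le> R ** N"
  using matrix_mul_nonneg[of R "N - M"] assms by (simp add: matrix_distribs)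

lemma matrix_mul_le_right:
  fixes M N :: "real^'m^'n" and R :: "real^'k^'m"
  assumes "0 \<le> R" "M \<le> N"
  shows "M ** R \<le> N ** R"
  using matrix_mul_nonneg[of "N - M" R] assms by (simp add: matrix_distribs)

lemma matrix_power_commute: "matrix_power M k ** M = M ** matrix_power M k"
  by (induction k) (simp_all add: matrix_mul_assoc[symmetric])

lemma matrix_power_nonneg: "0 \<le> M \<Longrightarrow> 0 \<le> matrix_power M k"
  by (induction k) (simp_all add: mat_1_nonneg matrix_mul_nonneg)

lemma matrix_power_intertwine: "M ** G = G ** N \<Longrightarrow> matrix_power M k ** G = G ** matrix_power N k"
  by (induction k) (simp_all, metis matrix_mul_assoc)

lemma matrix_power_fixes: "M ** P = P \<Longrightarrow> matrix_power M k ** P = P"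
  by (induction k) (simp_all add: matrix_mul_assoc[symmetric])

lemma matrix_power_mv: "matrix_power M k *v x = (((*v) M) ^^ k) x"
  by (induction k) (simp_all add: matrix_vector_mul_assoc[symmetric])

lemma matrix_mul_scaleR:
  fixes M :: "real^'m^'n" and N :: "real^'k^'m"
  shows "(c *\<^sub>R M) ** N = c *\<^sub>R (M ** N)" "M ** (c *\<^sub>R N) = c *\<^sub>R (M ** N)"
  by (simp_all add: matrix_matrix_mult_def vec_eq_iff sum_distrib_left algebra_simps)

lemma tendsto_matrix_mul:
  fixes F :: "'a \<Rightarrow> real^'m^'n" and F' :: "'a \<Rightarrow> real^'k^'m"
  assumes "(F \<longlongrightarrow> M) net" "(F' \<longlongrightarrow> N) net"
  shows "((\<lambda>x. F x ** F' x) \<longlongrightarrow> M ** N) net"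
  unfolding matrix_matrix_mult_def
  by (intro tendsto_vec_lambda tendsto_sum tendsto_mult tendsto_vec_nth assms)

lemma matrix_limit_nonneg:
  fixes F :: "nat \<Rightarrow> real^'m^'n"
  assumes "F \<longlonglongrightarrow> M" "\<And>k. 0 \<le> F k"
  shows "0 \<le> M"
  unfolding matrix_nonneg_iff
proof (intro allI)
  fix i j
  have "(\<lambda>k. F k $ i $ j) \<longlonglongrightarrow> M $ i $ j" by (intro tendsto_vec_nth assms)
  then show "0 \<le> M $ i $ j"
    by (rule LIMSEQ_le_const) (use assms(2) in \<open>auto simp: matrix_nonneg_iff\<close>)
qed

text \<open>The Cesaro means of the iterates of each vector stay bounded. The summand 1 makes the
  case \<open>m = 0\<close> yield \<open>0 <= c\<close>.\<close>

definition mean_bounded :: "real^'n^'n \<Rightarrow> bool" where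
  "mean_bounded W \<longleftrightarrow> (\<forall>v. \<exists>c. \<forall>m. norm (\<Sum>k<m. (((*v) W) ^^ k) v) \<le> c * (real m + 1))"

text \<open>With \<open>A = s (I - T)\<close>, the limit \<open>P\<close> of the powers of
  \<open>T\<close> projects onto the kernel of \<open>A\<close>, and \<open>A + P\<close> is
  invertible. \<open>C\<close> is its inverse plus a multiple of \<open>P\<close>; since
  \<open>A P = P A = 0\<close>, that multiple buys nonnegativity without changing \<open>A C\<close>
  and \<open>C A\<close>.\<close>

lemma property_c_projection:
  fixes A :: "real^'n^'n"
  assumes "property_c A"
  obtains P C where "0 \<le> P" "0 \<le> C" "A ** P = 0" "P ** A = 0" "A ** C = mat 1 - P" "C ** A = mat 1 - P"
proof -
  from assms obtain s B where s: "0 < s" and B: "0 \<le> B" and A: "A = s *\<^sub>R mat 1 - B"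
    and sc: "semiconvergent (inverse s *\<^sub>R B)"
    unfolding property_c_def M_matrix_representation_def by auto
  define T where "T = inverse s *\<^sub>R B"
  define T' where "T' k = matrix_power T k" for k
  have T: "0 \<le> T" unfolding T_def using s B by (simp add: matrix_nonneg_iff)
  have AT: "A = s *\<^sub>R (mat 1 - T)" using s by (simp add: T_def A scaleR_diff_right)
  obtain P where lim: "T' \<longlonglongrightarrow> P"
    using sc unfolding semiconvergent_def convergent_def T_def[symmetric] T'_def by auto
  have T'Suc: "T' (Suc k) = T ** T' k" "T' (Suc k) = T' k ** T" for k
    by (simp_all add: T'_def matrix_power_commute)
  have T'0: "0 \<le> T' k" for k by (simp add: T'_def matrix_power_nonneg T)
  have P0: "0 \<le> P" by (rule matrix_limit_nonneg[OF lim T'0])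
  have TP: "T ** P = P"
    by (rule LIMSEQ_unique[OF tendsto_matrix_mul[OF tendsto_const lim]])
      (use LIMSEQ_Suc[OF lim] in \<open>simp add: T'Suc(1)\<close>)
  have PT: "P ** T = P"
    by (rule LIMSEQ_unique[OF tendsto_matrix_mul[OF lim tendsto_const]])
      (use LIMSEQ_Suc[OF lim] in \<open>simp add: T'Suc(2)\<close>)
  have AP: "A ** P = 0" "P ** A = 0"
    by (simp_all add: AT matrix_mul_scaleR matrix_distribs TP PT)
  have PP: "P ** P = P"
    by (rule LIMSEQ_unique[OF tendsto_matrix_mul[OF lim tendsto_const]])
      (simp add: T'_def matrix_power_fixes TP)
  \<comment> \<open>Multiplying by \<open>P\<close> gives \<open>P x = 0\<close>, hence
    \<open>A x = 0\<close>; then every \<open>T' k\<close> fixes \<open>x\<close>, and the limit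
    gives \<open>x = P x = 0\<close>.\<close>
  have "x = 0" if "(A + P) *v x = 0" for x
  proof -
    have "P *v x = (P ** (A + P)) *v x" by (simp add: matrix_distribs AP PP)
    also have "\<dots> = 0" using that by (simp add: matrix_vector_mul_assoc[symmetric])
    finally have Px: "P *v x = 0" .
    then have "A *v x = 0" using that by (simp add: matrix_vector_mult_add_rdistrib)
    then have "T *v x = x"
      using s by (simp add: AT matrix_vector_mult_diff_rdistrib scaleR_matrix_vector_assoc[symmetric])
    then have "T' k *v x = x" for k by (induction k) (simp_all add: T'_def matrix_vector_mul_assoc[symmetric])
    moreover have "(\<lambda>k. T' k *v x) \<longlonglongrightarrow> P *v x"
      unfolding matrix_vector_mult_def
      by (intro tendsto_vec_lambda tendsto_sum tendsto_mult tendsto_vec_nth lim tendsto_const)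
    ultimately show "x = 0" using Px by (simp add: LIMSEQ_const_iff)
  qed
  \<comment> \<open>Off the support of \<open>P\<close>, the inverse \<open>Z\<close> of \<open>A + P\<close> is the limit of the partial sums
    \<open>E N \<ge> 0\<close>; on the support a large multiple of \<open>P\<close> makes \<open>Z + c P\<close> nonnegative.\<close>
  then obtain Z where Z1: "Z ** (A + P) = mat 1" using matrix_left_invertible_ker by blast
  then have Z2: "(A + P) ** Z = mat 1" using matrix_left_right_inverse by blast
  have "P ** Z = P ** (A + P) ** Z" by (simp add: matrix_distribs AP PP)
  then have PZ: "P ** Z = P" using Z2 by (simp add: matrix_mul_assoc[symmetric])
  have "Z ** P = Z ** ((A + P) ** P)" by (simp add: matrix_distribs AP PP)
  then have ZP: "Z ** P = P" using Z1 by (simp add: matrix_mul_assoc)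
  have AZ: "A ** Z = mat 1 - P" "Z ** A = mat 1 - P"
    using Z1 Z2 PZ ZP by (simp_all add: matrix_distribs algebra_simps)
  define E where "E N = inverse s *\<^sub>R (\<Sum>k<N. T' k)" for N
  have E0: "0 \<le> E N" for N
    using s T'0 by (auto simp: E_def matrix_nonneg_iff intro!: mult_nonneg_nonneg sum_nonneg)
  have EA: "E N ** A = mat 1 - T' N" for N
  proof (induction N)
    case (Suc N)
    have "E (Suc N) = E N + inverse s *\<^sub>R T' N" by (simp add: E_def scaleR_add_right)
    moreover have "(inverse s *\<^sub>R T' N) ** A = T' N - T' (Suc N)"
      using s by (simp add: matrix_distribs AT matrix_mul_scaleR T'Suc(2) scaleR_diff_right)
    ultimately show ?case using Suc by (simp add: matrix_distribs)
  qed (simp add: E_def T'_def)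
  have EP: "E N ** P = (real N / s) *\<^sub>R P" for N
  proof (induction N)
    case (Suc N)
    have "E (Suc N) = E N + inverse s *\<^sub>R T' N" by (simp add: E_def scaleR_add_right)
    with Suc show ?case
      by (simp add: matrix_distribs matrix_mul_scaleR T'_def matrix_power_fixes TP divide_inverse algebra_simps)
  qed (simp add: E_def)
  have EZ: "E N - (real N / s) *\<^sub>R P = Z - T' N ** Z" for N
  proof -
    have "E N ** (mat 1 - P) = (mat 1 - T' N) ** Z"
      by (simp only: AZ(1)[symmetric] matrix_mul_assoc EA)
    then show ?thesis by (simp add: matrix_distribs EP)
  qed
  \<comment> \<open>At a zero entry of \<open>P\<close> the growing term of \<open>EZ\<close>
    vanishes, and \<open>T' N ** Z\<close> tends to \<open>P ** Z = P\<close>, also zero there. So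
    the entry of \<open>Z\<close> is a limit of entries of \<open>E N\<close>.\<close>
  have Z_nonneg: "0 \<le> Z $ i $ j" if "P $ i $ j = 0" for i j
  proof -
    have "(\<lambda>N. (Z - T' N ** Z) $ i $ j) \<longlonglongrightarrow> (Z - P ** Z) $ i $ j"
      by (intro tendsto_vec_nth tendsto_diff tendsto_const tendsto_matrix_mul lim)
    moreover have "(Z - T' N ** Z) $ i $ j = E N $ i $ j" for N
      using EZ[of N] that by (metis diff_zero scaleR_zero_right vector_minus_component vector_scaleR_component)
    ultimately have "(\<lambda>N. E N $ i $ j) \<longlonglongrightarrow> Z $ i $ j" using that PZ by simp
    then show ?thesis
      by (rule LIMSEQ_le_const) (use E0 in \<open>auto simp: matrix_nonneg_iff\<close>)
  qed
  \<comment> \<open>Terms with \<open>P $ i $ j = 0\<close> contribute \<open>x / 0 = 0\<close>.\<close>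
  define c where "c = (\<Sum>i\<in>UNIV. \<Sum>j\<in>UNIV. \<bar>Z $ i $ j\<bar> / P $ i $ j)"
  define C where "C = Z + c *\<^sub>R P"
  have C0: "0 \<le> C"
    unfolding matrix_nonneg_iff
  proof (intro allI)
    fix i j
    show "0 \<le> C $ i $ j"
    proof (cases "P $ i $ j = 0")
      case True
      with Z_nonneg show ?thesis by (simp add: C_def)
    next
      case False
      have P0': "0 \<le> P $ i $ j" for i j using P0 by (simp add: matrix_nonneg_iff)
      with False have P: "0 < P $ i $ j" by (simp add: order_less_le)
      have "\<bar>Z $ i $ j\<bar> / P $ i $ j \<le> (\<Sum>j\<in>UNIV. \<bar>Z $ i $ j\<bar> / P $ i $ j)"
        using P0' by (intro member_le_sum) auto
      also have "\<dots> \<le> c"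
        unfolding c_def using P0' by (intro member_le_sum) (auto intro: sum_nonneg)
      finally have "\<bar>Z $ i $ j\<bar> \<le> c * P $ i $ j" using P by (simp add: field_simps)
      then show ?thesis by (simp add: C_def)
    qed
  qed
  show ?thesis
    by (rule that[OF P0 C0 AP]) (simp_all add: C_def matrix_distribs matrix_mul_scaleR AZ AP)
qed

text \<open>The sums \<open>S m\<close> of \<open>W^k G\<close> satisfy
  \<open>S m A = I - W^m\<close> and \<open>A S m = I - W'^m\<close>. Multiplying by
  \<open>C\<close> and dropping nonnegative terms bounds \<open>S m\<close> by
  \<open>C + S m P\<close> and by \<open>C + P S m\<close>, so only the compression
  \<open>P S m P\<close> can grow, and it grows at most linearly.\<close>

lemma mean_bounded_of_property_c:
  fixes A G :: "real^'n^'n"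
  assumes "property_c A" "0 \<le> G" "invertible G"
    and W0: "0 \<le> mat 1 - G ** A" and W0': "0 \<le> mat 1 - A ** G"
  shows "mean_bounded (mat 1 - G ** A)"
proof -
  obtain P C where P: "0 \<le> P" and C: "0 \<le> C" and AP: "A ** P = 0" and PA: "P ** A = 0"
    and AC: "A ** C = mat 1 - P" and CA: "C ** A = mat 1 - P"
    by (rule property_c_projection[OF assms(1)])
  define W W' where "W = mat 1 - G ** A" and "W' = mat 1 - A ** G"
  have W: "0 \<le> W" and W': "0 \<le> W'" using W0 W0' by (simp_all add: W_def W'_def)
  have WG: "W ** G = G ** W'" by (simp add: W_def W'_def matrix_distribs matrix_mul_assoc)
  have WP: "W ** P = P" by (simp add: W_def matrix_distribs matrix_mul_assoc[symmetric] AP)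
  have PW': "P ** W' = P" by (simp add: W'_def matrix_distribs matrix_mul_assoc PA)
  define S where "S m = (\<Sum>k<m. matrix_power W k ** G)" for m
  have S_Suc: "S (Suc m) = S m + matrix_power W m ** G" for m by (simp add: S_def)
  have S_0: "S 0 = 0" by (simp add: S_def)
  have WkG: "matrix_power W k ** G = G ** matrix_power W' k" for k
    by (rule matrix_power_intertwine[OF WG])
  have S0: "0 \<le> S m" for m
    by (induction m) (simp_all add: S_0 S_Suc matrix_mul_nonneg matrix_power_nonneg W assms(2))
  \<comment> \<open>Peeling off the first summand puts \<open>W'\<close> on the right, where
    \<open>P W' = P\<close> can act.\<close>
  have S_Suc': "S (Suc m) = G + S m ** W'" for m
  proof (induction m)
    case (Suc m)
    have "matrix_power W (Suc m) ** G = matrix_power W m ** G ** W'"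
      unfolding WkG
      using matrix_power_commute[of W' m]
      by (simp add: matrix_mul_assoc[symmetric])
    then have "S (Suc (Suc m)) = G + (S m + matrix_power W m ** G) ** W'"
      unfolding S_Suc[of "Suc m"] Suc by (simp only: matrix_distribs add.assoc)
    then show ?case by (simp only: S_Suc[of m])
  qed (simp add: S_0 S_Suc)
  have SA: "S m ** A = mat 1 - matrix_power W m" for m
  proof (induction m)
    case (Suc m)
    have "matrix_power W m ** G ** A = matrix_power W m ** (mat 1 - W)"
      by (simp add: W_def matrix_mul_assoc[symmetric])
    with Suc show ?case
      by (simp add: S_Suc matrix_distribs matrix_power_commute)
  qed (simp add: S_0)
  have AS: "A ** S m = mat 1 - matrix_power W' m" for m
  proof (induction m)
    case (Suc m)
    have "A ** (matrix_power W m ** G) = (mat 1 - W') ** matrix_power W' m"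
      by (simp add: WkG W'_def matrix_mul_assoc)
    with Suc show ?case
      by (simp add: S_Suc matrix_distribs)
  qed (simp add: S_0)
  have SP: "S m \<le> C + S m ** P" for m
  proof -
    have "S m ** (mat 1 - P) = (mat 1 - matrix_power W m) ** C"
      by (simp only: AC[symmetric] matrix_mul_assoc SA)
    then have "S m = C + S m ** P - matrix_power W m ** C" by (simp add: matrix_distribs algebra_simps)
    with matrix_mul_nonneg[OF matrix_power_nonneg[OF W] C, of m] show ?thesis
      by (metis add.commute le_add_same_cancel1 diff_add_cancel)
  qed
  have PS: "S m \<le> C + P ** S m" for m
  proof -
    have "(mat 1 - P) ** S m = C ** (mat 1 - matrix_power W' m)"
      by (simp only: CA[symmetric] matrix_mul_assoc[symmetric] AS)
    then have "S m = C + P ** S m - C ** matrix_power W' m" by (simp add: matrix_distribs algebra_simps)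
    with matrix_mul_nonneg[OF C matrix_power_nonneg[OF W'], of m] show ?thesis
      by (metis add.commute le_add_same_cancel1 diff_add_cancel)
  qed
  have CW': "C ** W' = C - G + P ** G"
    by (simp add: W'_def matrix_distribs matrix_mul_assoc CA algebra_simps)
  \<comment> \<open>Inserting \<open>SP\<close> into \<open>S_Suc'\<close> produces
    \<open>C W' = C - G + P G\<close>, whose \<open>- G\<close> cancels the leading
    \<open>G\<close>.\<close>
  have step: "S (Suc m) \<le> (C + P ** G) + S m ** P" for m
  proof -
    have "S m ** W' \<le> (C + S m ** P) ** W'" by (rule matrix_mul_le_right[OF W' SP])
    also have "\<dots> = C - G + P ** G + S m ** P"
      by (simp add: matrix_distribs CW' matrix_mul_assoc[symmetric] PW')
    finally show ?thesis by (simp add: S_Suc' algebra_simps)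
  qed
  define Q where "Q = P ** (C + P ** G) ** P"
  have PP: "P ** P = P"
  proof -
    have "P ** (mat 1 - P) = 0" by (simp add: AC[symmetric] matrix_mul_assoc PA)
    then show ?thesis by (simp add: matrix_distribs)
  qed
  \<comment> \<open>Compressing by \<open>P\<close> on both sides turns \<open>step\<close> into a recursion with constant increment.\<close>
  have PSP: "P ** S m ** P \<le> real m *\<^sub>R Q" for m
  proof (induction m)
    case (Suc m)
    have "P ** S (Suc m) ** P \<le> P ** ((C + P ** G) + S m ** P) ** P"
      by (intro matrix_mul_le_right matrix_mul_le_left P step)
    also have "\<dots> = Q + P ** S m ** P"
      by (simp add: Q_def matrix_distribs matrix_mul_assoc[symmetric] PP)
    also have "\<dots> \<le> Q + real m *\<^sub>R Q" using Suc by simp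
    finally show ?case by (simp add: algebra_simps)
  qed (simp add: S_0)
  \<comment> \<open>Using \<open>PS\<close> first and \<open>SP\<close> inside it reduces everything
    to the two-sided compression.\<close>
  have bound: "S m \<le> (C + P ** C) + real m *\<^sub>R Q" for m
  proof -
    have "S m \<le> C + P ** S m" by (rule PS)
    also have "\<dots> \<le> C + P ** (C + S m ** P)"
      by (intro add_left_mono matrix_mul_le_left P SP)
    also have "\<dots> = (C + P ** C) + P ** S m ** P"
      by (simp add: matrix_distribs matrix_mul_assoc)
    finally show ?thesis using PSP[of m] by (meson add_left_mono order_trans)
  qed
  \<comment> \<open>The sum of moduli of the entries dominates the operator norm and is monotone on
    nonnegative matrices, so it turns \<open>bound\<close> into a norm estimate.\<close>
  define e where "e R = (\<Sum>i\<in>UNIV. \<Sum>j\<in>UNIV. \<bar>R $ i $ j\<bar>)" for R :: "real^'n^'n"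
  have e: "norm (R *v v) \<le> e R * norm v" for R :: "real^'n^'n" and v
  proof -
    have "norm (R *v v) \<le> (\<Sum>i\<in>UNIV. \<bar>(R *v v) $ i\<bar>)" by (rule norm_le_l1_cart)
    also have "\<dots> \<le> (\<Sum>i\<in>UNIV. \<Sum>j\<in>UNIV. \<bar>R $ i $ j\<bar> * norm v)"
      unfolding matrix_vector_mult_def
      by (intro sum_mono) (auto intro!: order_trans[OF sum_abs] sum_mono mult_left_mono
          component_le_norm_cart simp: abs_mult)
    finally show ?thesis by (simp add: e_def sum_distrib_right)
  qed
  have eS: "e (S m) \<le> e (C + P ** C) + real m * e Q" for m
  proof -
    have "\<bar>S m $ i $ j\<bar> \<le> \<bar>(C + P ** C) $ i $ j\<bar> + real m * \<bar>Q $ i $ j\<bar>" for i j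
    proof -
      have "0 \<le> S m $ i $ j" using S0[of m] by (simp add: matrix_nonneg_iff)
      moreover have "S m $ i $ j \<le> ((C + P ** C) + real m *\<^sub>R Q) $ i $ j"
        using bound[of m] by (simp add: less_eq_vec_def)
      moreover have "real m * Q $ i $ j \<le> real m * \<bar>Q $ i $ j\<bar>" by (intro mult_left_mono) auto
      ultimately show ?thesis by simp
    qed
    then show ?thesis
      unfolding e_def sum_distrib_left sum.distrib[symmetric] by (intro sum_mono)
  qed
  have e0: "0 \<le> e R" for R by (auto simp: e_def intro!: sum_nonneg)
  obtain G' where G': "G ** G' = mat 1" using assms(3) by (auto simp: invertible_def)
  show ?thesis
    unfolding mean_bounded_def W_def[symmetric]
  proof (intro allI)
    fix v
    \<comment> \<open>\<open>v = G w\<close>, so the bound on sums of \<open>W^k G\<close> becomes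
      one on the iterates of \<open>v\<close>.\<close>
    define w where "w = G' *v v"
    have "(\<Sum>k<m. (((*v) W) ^^ k) v) = S m *v w" for m
    proof (induction m)
      case (Suc m)
      have "(((*v) W) ^^ m) v = (matrix_power W m ** G) *v w"
        by (simp add: w_def matrix_vector_mul_assoc matrix_mul_assoc[symmetric] G' matrix_power_mv)
      with Suc show ?case by (simp add: S_Suc matrix_vector_mult_add_rdistrib)
    qed (simp add: S_0)
    then have "norm (\<Sum>k<m. (((*v) W) ^^ k) v) \<le> (e (C + P ** C) + real m * e Q) * norm w" for m
      using order_trans[OF e mult_right_mono[OF eS norm_ge_zero]] by simp
    also have "(e (C + P ** C) + real m * e Q) * norm w
        \<le> ((e (C + P ** C) + e Q) * norm w) * (real m + 1)" for m
    proof -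
      have "e (C + P ** C) + real m * e Q \<le> (e (C + P ** C) + e Q) * (real m + 1)"
        using e0[of "C + P ** C"] e0[of Q] by (simp add: algebra_simps)
      from mult_right_mono[OF this norm_ge_zero[of w]] show ?thesis by (simp add: mult_ac)
    qed
    finally show "\<exists>c. \<forall>m. norm (\<Sum>k<m. (((*v) W) ^^ k) v) \<le> c * (real m + 1)" by blast
  qed
qed

subsection \<open>Convergence of the iterations\<close>

text \<open>Iterating gives \<open>f^m a <= W^m a\<close>, while \<open>W^m a\<close> is a
  difference of consecutive partial sums and grows at most linearly; dividing by \<open>f^m\<close>
  forces \<open>a <= 0\<close>.\<close>

lemma mean_bounded_expanding_vector:
  fixes W :: "real^'n^'n"
  assumes W: "0 \<le> W" "mean_bounded W" and a: "0 \<le> a" "f *\<^sub>R a \<le> W *v a" and f: "1 < f"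
  shows "a = 0"
proof -
  have mono: "W *v x \<le> W *v y" if "x \<le> y" for x y
    using that W(1) unfolding less_eq_vec_def matrix_vector_mult_def
    by (auto intro!: sum_mono mult_left_mono)
  have iter: "f ^ m *\<^sub>R a \<le> (((*v) W) ^^ m) a" for m
  proof (induction m)
    case (Suc m)
    have "f ^ Suc m *\<^sub>R a = f ^ m *\<^sub>R (f *\<^sub>R a)" by simp
    also have "\<dots> \<le> f ^ m *\<^sub>R (W *v a)" using a f by (intro scaleR_left_mono) auto
    also have "\<dots> = W *v (f ^ m *\<^sub>R a)" by (simp add: matrix_vector_mult_scaleR)
    also have "\<dots> \<le> W *v ((((*v) W) ^^ m) a)" by (rule mono[OF Suc])
    finally show ?case by simp
  qed simp
  obtain c where c: "\<And>m. norm (\<Sum>k<m. (((*v) W) ^^ k) a) \<le> c * (real m + 1)"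
    using W(2) unfolding mean_bounded_def by blast
  have growth: "norm ((((*v) W) ^^ m) a) \<le> c * (2 * real m + 3)" for m
  proof -
    have "(((*v) W) ^^ m) a = (\<Sum>k<Suc m. (((*v) W) ^^ k) a) - (\<Sum>k<m. (((*v) W) ^^ k) a)" by simp
    then have "norm ((((*v) W) ^^ m) a) \<le> c * (real (Suc m) + 1) + c * (real m + 1)"
      using norm_triangle_ineq4 c[of m] c[of "Suc m"] by (smt (verit, best))
    then show ?thesis by (simp add: algebra_simps)
  qed
  show "a = 0"
    unfolding vec_eq_iff
  proof
    fix i
    define q where "q = inverse f"
    have q: "0 < q" "q < 1" "q * f = 1" using f by (auto simp: q_def inverse_less_1_iff)
    have "a $ i \<le> c * (2 * (real m * q ^ m) + 3 * q ^ m)" for m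
    proof -
      have "f ^ m * a $ i \<le> (((*v) W) ^^ m) a $ i"
        using iter[of m] by (simp add: less_eq_vec_def)
      also have "\<dots> \<le> c * (2 * real m + 3)"
        using component_le_norm_cart[of "(((*v) W) ^^ m) a" i] growth[of m] by linarith
      finally have "q ^ m * (f ^ m * a $ i) \<le> q ^ m * (c * (2 * real m + 3))"
        using q by (intro mult_left_mono) auto
      moreover have "q ^ m * (f ^ m * a $ i) = a $ i"
        using q by (simp add: power_mult_distrib[symmetric] mult.assoc[symmetric])
      ultimately show ?thesis by (simp only:) (simp add: algebra_simps)
    qed
    moreover have "(\<lambda>m. c * (2 * (real m * q ^ m) + 3 * q ^ m)) \<longlonglongrightarrow> c * (2 * 0 + 3 * 0)"
      using q by (intro tendsto_intros powser_times_n_limit_0 LIMSEQ_power_zero) auto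
    ultimately have "a $ i \<le> 0" by (intro LIMSEQ_le_const) auto
    moreover have "0 \<le> a $ i" using a(1) by (simp add: less_eq_vec_def)
    ultimately show "a $ i = 0 $ i" by simp
  qed
qed

text \<open>Along the chain \<open>W^k a = a + k b\<close>, so the partial sums would grow
  quadratically unless \<open>b = 0\<close>.\<close>

lemma mean_bounded_no_jordan_chain:
  fixes W :: "real^'n^'n"
  assumes W: "mean_bounded W" and b: "W *v b = b" "W *v a = a + b"
  shows "b = 0"
proof (rule ccontr)
  assume "b \<noteq> 0"
  have iter: "(((*v) W) ^^ k) a = a + real k *\<^sub>R b" for k
    by (induction k) (simp_all add: matrix_vector_right_distrib matrix_vector_mult_scaleR b algebra_simps)
  have total: "2 *\<^sub>R (\<Sum>k<m. (((*v) W) ^^ k) a) = (2 * real m) *\<^sub>R a + (real m * (real m - 1)) *\<^sub>R b" for m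
  proof (induction m)
    case (Suc m)
    have unfold: "2 *\<^sub>R (\<Sum>k<Suc m. (((*v) W) ^^ k) a)
        = 2 *\<^sub>R (\<Sum>k<m. (((*v) W) ^^ k) a) + 2 *\<^sub>R (a + real m *\<^sub>R b)"
      by (simp add: iter scaleR_add_right)
    show ?case unfolding unfold Suc by (simp add: vec_eq_iff algebra_simps)
  qed simp
  obtain c where c: "\<And>m. norm (\<Sum>k<m. (((*v) W) ^^ k) a) \<le> c * (real m + 1)"
    using W unfolding mean_bounded_def by blast
  have c0: "0 \<le> c" using c[of 0] by simp
  \<comment> \<open>After division by \<open>m = k + 1\<close>, the term
    \<open>2 c (m + 1) / m\<close> is at most \<open>4 c\<close>.\<close>
  define d where "d = 4 * c + 2 * norm a"
  have "real k * norm b \<le> d" for k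
  proof -
    define m where "m = Suc k"
    have "real m * real k * norm b = norm ((real m * (real m - 1)) *\<^sub>R b)" by (simp add: m_def abs_mult)
    also have "\<dots> = norm (2 *\<^sub>R (\<Sum>k<m. (((*v) W) ^^ k) a) - (2 * real m) *\<^sub>R a)"
      by (simp add: total)
    also have "\<dots> \<le> 2 * (c * (real m + 1)) + 2 * real m * norm a"
      using norm_triangle_ineq4[of "2 *\<^sub>R (\<Sum>k<m. (((*v) W) ^^ k) a)" "(2 * real m) *\<^sub>R a"] c[of m] by simp
    also have "\<dots> \<le> real m * d"
      using c0 by (simp add: d_def m_def algebra_simps)
    finally have "real m * (real k * norm b) \<le> real m * d" by (simp add: mult.assoc)
    then show ?thesis by (simp add: m_def)
  qed
  moreover obtain k where "d < real k * norm b"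
    using ex_less_of_nat_mult[of "norm b" d] \<open>b \<noteq> 0\<close> by auto
  ultimately show False by (meson not_le)
qed

text \<open>The disc of radius \<open>1 - e\<close> about \<open>e\<close> (empty for
  \<open>e > 1\<close>) lies in the closed unit disc and meets the unit circle at most in 1.\<close>

lemma shifted_norm_gt_1:
  assumes z: "1 \<le> cmod z" "z \<noteq> 1" and e: "0 < e"
  shows "1 < cmod (z - of_real e) + e"
proof (rule ccontr)
  assume "\<not> ?thesis"
  then have le: "cmod (z - of_real e) \<le> 1 - e" by simp
  then have Re1: "Re z \<le> 1" using complex_Re_le_cmod[of "z - of_real e"] by simp
  have "(cmod (z - of_real e))\<^sup>2 \<le> (1 - e)\<^sup>2" using le by (intro power_mono) auto
  then have "(Re z)\<^sup>2 + (Im z)\<^sup>2 - 1 \<le> 2 * (e * (Re z - 1))"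
    unfolding cmod_power2 by (simp add: power2_eq_square algebra_simps)
  moreover have "1 \<le> (Re z)\<^sup>2 + (Im z)\<^sup>2"
    using power_mono[OF z(1), of 2] by (simp add: cmod_power2)
  ultimately have "0 \<le> e * (Re z - 1)" by linarith
  with e have "1 \<le> Re z" by (simp add: zero_le_mult_iff)
  with Re1 have Re: "Re z = 1" by simp
  with \<open>(Re z)\<^sup>2 + (Im z)\<^sup>2 - 1 \<le> _\<close> have "(Im z)\<^sup>2 \<le> 0" by simp
  with Re z(2) show False by (simp add: complex_eq_iff)
qed

text \<open>\<open>settles_all\<close> is applied to the complexification of \<open>W\<close>, and
  real parts are taken at the end. The positive diagonal excludes peripheral eigenvalues other than
  1; the linear bound excludes Jordan chains at 1.\<close>

lemma iterates_converge:
  fixes W :: "real^'n^'n"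
  assumes W: "0 \<le> W" "mean_bounded W" and e: "0 < e" "\<And>i. e \<le> W $ i $ i"
  obtains l where "W *v l = l" "(\<lambda>m. (((*v) W) ^^ m) x) \<longlonglongrightarrow> l"
proof -
  define M where "M = map_matrix complex_of_real W"
  define R where "R v = (\<chi> i. Re (v $ i))" for v :: "complex^'n"
  define J where "J v = (\<chi> i. Im (v $ i))" for v :: "complex^'n"
  have RM: "R (M *v v) = W *v R v" and JM: "J (M *v v) = W *v J v" for v
    by (simp_all add: R_def J_def M_def matrix_vector_mult_def)
  have "z = 1 \<or> u = 0" if z: "1 \<le> cmod z" and u: "M *v u = z *s u" for z u
  proof (rule disjCI)
    assume "u \<noteq> 0"
    \<comment> \<open>The vector of moduli expands, because the diagonal part \<open>e I\<close> can be split off \<open>W\<close>.\<close>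
    define a where "a = (\<chi> i. cmod (u $ i))"
    have "(cmod (z - of_real e) + e) *\<^sub>R a \<le> W *v a"
      unfolding less_eq_vec_def
    proof
      fix i
      define D where "D j = W $ i $ j - (if j = i then e else 0)" for j
      have D0: "0 \<le> D j" for j
        using W(1) e(2)[of i] by (auto simp: D_def matrix_nonneg_iff)
      have "(\<Sum>j\<in>UNIV. of_real (D j) * u $ j) = (M *v u) $ i - of_real e * u $ i"
        by (simp add: D_def M_def matrix_vector_mult_def left_diff_distrib sum_subtractf
            if_distrib[of of_real] if_distrib[of "\<lambda>c. c * _"] sum.delta cong: if_cong)
      also have "\<dots> = (z - of_real e) * u $ i" by (simp add: u algebra_simps)
      finally have "cmod (z - of_real e) * cmod (u $ i) = cmod (\<Sum>j\<in>UNIV. of_real (D j) * u $ j)"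
        by (simp add: norm_mult)
      also have "\<dots> \<le> (\<Sum>j\<in>UNIV. D j * a $ j)"
        using D0 by (intro sum_norm_le) (simp add: norm_mult a_def)
      also have "\<dots> = (W *v a) $ i - e * a $ i"
        by (simp add: D_def matrix_vector_mult_def left_diff_distrib sum_subtractf
            if_distrib[of "\<lambda>c. c * _"] sum.delta cong: if_cong)
      finally show "((cmod (z - of_real e) + e) *\<^sub>R a) $ i \<le> (W *v a) $ i"
        by (simp add: a_def algebra_simps)
    qed
    moreover have "0 \<le> a" "a \<noteq> 0"
      using \<open>u \<noteq> 0\<close> by (auto simp: a_def less_eq_vec_def vec_eq_iff)
    ultimately have "\<not> 1 < cmod (z - of_real e) + e"
      using mean_bounded_expanding_vector[OF W, of a] by blast
    then show "z = 1" using shifted_norm_gt_1[OF z _ e(1)] by blast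
  qed
  moreover have "y = 0" if "M *v y = y" "M *v x = x + y" for x y
  proof -
    \<comment> \<open>Real and imaginary parts of a complex chain are real chains, since
      \<open>W\<close> is real.\<close>
    have "R (x + y) = R x + R y" "J (x + y) = J x + J y" by (simp_all add: R_def J_def vec_eq_iff)
    with that have "R y = 0" "J y = 0"
      using mean_bounded_no_jordan_chain[OF W(2)] RM JM by metis+
    then show ?thesis by (simp add: R_def J_def vec_eq_iff complex_eq_iff)
  qed
  ultimately have "settles M v" for v by (rule settles_all)
  then obtain l where l: "M *v l = l" "decays M ((\<chi> i. of_real (x $ i)) - l)"
    unfolding settles_def by blast
  then obtain c q where q: "0 < q" "q < 1"
    and cq: "\<And>m. norm ((((*v) M) ^^ m) ((\<chi> i. of_real (x $ i)) - l)) \<le> c * q ^ m"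
    unfolding decays_def by auto
  have Wl: "W *v R l = R l" using RM[of l] l(1) by simp
  have iterR: "R ((((*v) M) ^^ m) v) = (((*v) W) ^^ m) (R v)" for m v
    by (induction m) (simp_all add: RM)
  have normR: "norm (R v) \<le> norm v" for v
    unfolding norm_vec_def R_def by (intro L2_set_mono) (auto simp: abs_Re_le_cmod)
  have "(\<lambda>m. (((*v) W) ^^ m) x - R l) \<longlonglongrightarrow> 0"
  proof (rule Lim_null_comparison)
    show "\<forall>\<^sub>F m in sequentially. norm ((((*v) W) ^^ m) x - R l) \<le> c * q ^ m"
    proof (intro always_eventually allI)
      fix m
      have "(((*v) W) ^^ m) x - R l = (((*v) W) ^^ m) (x - R l)"
        by (simp add: funpow_mv_diff funpow_mv_fixed Wl)
      also have "x - R l = R ((\<chi> i. of_real (x $ i)) - l)" by (simp add: R_def vec_eq_iff)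
      also have "(((*v) W) ^^ m) \<dots> = R ((((*v) M) ^^ m) ((\<chi> i. of_real (x $ i)) - l))"
        by (simp add: iterR)
      finally show "norm ((((*v) W) ^^ m) x - R l) \<le> c * q ^ m"
        using order_trans[OF normR cq] by simp
    qed
    show "(\<lambda>m. c * q ^ m) \<longlonglongrightarrow> 0"
      using q by (intro tendsto_mult_right_zero LIMSEQ_power_zero) auto
  qed
  then show ?thesis using that[OF Wl] by (simp add: LIM_zero_iff)
qed

text \<open>A solution \<open>z\<close> is a fixed point, so the error \<open>x k - z\<close> is
  iterated by \<open>W\<close>. Its limit satisfies \<open>G A l = 0\<close>, and invertibility of
  \<open>G\<close> puts it in the kernel of \<open>A\<close>.\<close>

lemma affine_iteration_converges:
  fixes A G :: "real^'n^'n"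
  assumes A: "property_c A" and G: "0 \<le> G" "invertible G"
    and W: "0 \<le> mat 1 - G ** A" "0 \<le> mat 1 - A ** G"
    and diag: "\<And>i. 0 < (mat 1 - G ** A) $ i $ i"
    and b: "A *v z = b"
    and x: "\<And>k. x (Suc k) = (mat 1 - G ** A) *v x k + G *v b"
  obtains l where "x \<longlonglongrightarrow> l" "A *v l = b"
proof -
  define W where "W = mat 1 - G ** A"
  define e where "e = Min (range (\<lambda>i. W $ i $ i))"
  have "0 < e" unfolding e_def W_def using diag by (subst Min_gr_iff) auto
  moreover have "e \<le> W $ i $ i" for i unfolding e_def by (intro Min_le) auto
  moreover have "0 \<le> W" "mean_bounded W"
    using W(1) mean_bounded_of_property_c[OF A G W] by (simp_all add: W_def)
  ultimately obtain l where l: "W *v l = l" "(\<lambda>m. (((*v) W) ^^ m) (x 0 - z)) \<longlonglongrightarrow> l"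
    using iterates_converge[of W e "x 0 - z"] by blast
  have "(((*v) W) ^^ k) (x 0 - z) = x k - z" for k
  proof (induction k)
    case (Suc k)
    have "x (Suc k) - z = W *v (x k - z)"
      by (simp add: x W_def b[symmetric] matrix_vector_mult_diff_rdistrib matrix_vector_mult_diff_distrib
          matrix_vector_mul_assoc)
    with Suc show ?case by simp
  qed simp
  with l(2) have "(\<lambda>k. x k - z) \<longlonglongrightarrow> l" by simp
  then have "(\<lambda>k. (x k - z) + z) \<longlonglongrightarrow> l + z" by (intro tendsto_add tendsto_const)
  then have "x \<longlonglongrightarrow> l + z" by simp
  moreover have "G *v (A *v l) = 0"
    using l(1) by (simp add: W_def matrix_vector_mult_diff_rdistrib matrix_vector_mul_assoc)
  then have "A *v l = 0" using inj_matrix_vector_mult[OF G(2)] by (metis injD matrix_vector_mult_0_right)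
  then have "A *v (l + z) = b" using b by (simp add: matrix_vector_right_distrib)
  ultimately show ?thesis by (rule that)
qed

section \<open>Splitting identities and the three-step scheme\<close>

lemma matrix_inv_cancel:
  fixes U :: "real^'n^'n"
  assumes "invertible U"
  shows "matrix_inv U ** U = mat 1" "U ** matrix_inv U = mat 1"
  using someI_ex[OF assms[unfolded invertible_def]] by (simp_all add: matrix_inv_def)

text \<open>Both orders of the product are recorded: one builds \<open>I - G A\<close>, the other
  \<open>I - A G\<close>.\<close>

lemma regular_splittingD:
  fixes A U V :: "real^'n^'n"
  assumes "regular_splitting A U V"
  shows "matrix_inv U ** V = mat 1 - matrix_inv U ** A" "V ** matrix_inv U = mat 1 - A ** matrix_inv U"
    "0 \<le> V ** matrix_inv U"
proof -
  have *: "V = U - A" "invertible U" "0 \<le> matrix_inv U" "0 \<le> V"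
    using assms by (auto simp: regular_splitting_def)
  show "matrix_inv U ** V = mat 1 - matrix_inv U ** A" "V ** matrix_inv U = mat 1 - A ** matrix_inv U"
    using *(1,2) by (simp_all add: matrix_distribs matrix_inv_cancel)
  show "0 \<le> V ** matrix_inv U"
    using *(3,4) by (simp add: matrix_mul_nonneg)
qed

theorem theorem4p7:
  fixes A K L U V X Y H :: "real^'n^'n"
    and b bhat :: "real^'n"
  assumes "M_matrix A" and "property_c A"
    and "regular_splitting A K L"
    and "regular_splitting A U V"
    and "regular_splitting A X Y"
    and "invertible (K + X - A + Y ** matrix_inv U ** L)"
    and "\<exists>z. A *v z = b"
    and "H = matrix_inv X ** Y ** matrix_inv U ** V ** matrix_inv K ** L"
    and "bhat = (matrix_inv X **
           (Y ** matrix_inv U ** V ** matrix_inv K + Y ** matrix_inv U + mat 1)) *v b"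
  shows "((\<forall>i. 0 < H $ i $ i) \<longrightarrow>
           (\<forall>x :: nat \<Rightarrow> real^'n.
              (\<forall>k. x (Suc k) = H *v x k + bhat) \<longrightarrow>
              (\<exists>l. x \<longlonglongrightarrow> l \<and> A *v l = b))) \<and>
         (\<forall>\<delta>::real. 0 < \<delta> \<and> \<delta> < 1 \<longrightarrow>
           (\<forall>x :: nat \<Rightarrow> real^'n.
              (\<forall>k. x (Suc k) = \<delta> *\<^sub>R (H *v x k + bhat) + (1 - \<delta>) *\<^sub>R x k) \<longrightarrow>
              (\<exists>l. x \<longlonglongrightarrow> l \<and> A *v l = b)))"
proof -
  let ?K = "matrix_inv K" and ?U = "matrix_inv U" and ?X = "matrix_inv X"
  note rK = regular_splittingD[OF assms(3)] and rU = regular_splittingD[OF assms(4)]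
    and rX = regular_splittingD[OF assms(5)]
  have eqs: "K = A + L" "U = A + V" "X = A + Y" and inv: "invertible K" "invertible U" "invertible X"
    and nonneg: "0 \<le> ?K" "0 \<le> ?U" "0 \<le> ?X" "0 \<le> L" "0 \<le> V" "0 \<le> Y"
    using assms(3-5) unfolding regular_splitting_def by (auto simp: eq_diff_eq)
  obtain z where z: "A *v z = b" using assms(7) by blast
  define G where "G = ?X ** (Y ** ?U ** V ** ?K + Y ** ?U + mat 1)"
  have bhat: "bhat = G *v b" by (simp add: G_def assms(9))
  have G0: "0 \<le> G"
    unfolding G_def using nonneg by (intro matrix_mul_nonneg add_nonneg_nonneg mat_1_nonneg)
  \<comment> \<open>Pulling \<open>?K\<close> out on the right and using
    \<open>V + K = U + L\<close> exposes the matrix assumed nonsingular.\<close>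
  have "G = ?X ** (K + X - A + Y ** ?U ** L) ** ?K"
  proof -
    have "Y ** ?U ** V ** ?K + Y ** ?U + mat 1 = (Y ** ?U ** (V + K) + K) ** ?K"
      using inv by (simp add: matrix_distribs matrix_inv_cancel matrix_mul_assoc[symmetric])
    also have "V + K = U + L" using eqs by simp
    also have "Y ** ?U ** (U + L) + K = K + X - A + Y ** ?U ** L"
      using inv eqs(3) by (simp add: matrix_distribs matrix_inv_cancel matrix_mul_assoc[symmetric])
    finally show ?thesis by (simp add: G_def matrix_mul_assoc)
  qed
  moreover have "invertible ?X" "invertible ?K"
    using inv matrix_inv_cancel by (auto simp: invertible_def)
  ultimately have Ginv: "invertible G" using assms(6) by (simp add: invertible_mult)
  \<comment> \<open>Written in \<open>A\<close> and the three inverses alone, \<open>G\<close> makes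
    \<open>I - G A\<close> and \<open>I - A G\<close> factor into one term per splitting.\<close>
  have Gpoly: "G = (mat 1 - ?X ** A) ** (mat 1 - ?U ** A) ** ?K + (mat 1 - ?X ** A) ** ?U + ?X"
    by (simp add: G_def matrix_distribs rX(1)[symmetric] rU(1)[symmetric] matrix_mul_assoc)
  have "H = (?X ** Y) ** (?U ** V) ** (?K ** L)" by (simp add: assms(8) matrix_mul_assoc)
  then have HG: "H = mat 1 - G ** A"
    unfolding rX(1) rU(1) rK(1) Gpoly by (simp add: matrix_distribs matrix_mul_assoc algebra_simps)
  have H0: "0 \<le> H" unfolding assms(8) using nonneg by (intro matrix_mul_nonneg)
  have "(Y ** ?X) ** (V ** ?U) ** (L ** ?K) = mat 1 - A ** G"
    unfolding rX(2) rU(2) rK(2) Gpoly by (simp add: matrix_distribs matrix_mul_assoc algebra_simps)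
  then have H'0: "0 \<le> mat 1 - A ** G"
    using rX(3) rU(3) rK(3) by (metis matrix_mul_nonneg)
  show ?thesis
  proof (intro conjI allI impI)
    fix x assume "\<forall>i. 0 < H $ i $ i" and "\<forall>k. x (Suc k) = H *v x k + bhat"
    then show "\<exists>l. x \<longlonglongrightarrow> l \<and> A *v l = b"
      using affine_iteration_converges[OF assms(2) G0 Ginv _ H'0 _ z, of x] H0 bhat
      unfolding HG by blast
  next
    fix \<delta> :: real and x
    assume \<delta>: "0 < \<delta> \<and> \<delta> < 1"
      and x: "\<forall>k. x (Suc k) = \<delta> *\<^sub>R (H *v x k + bhat) + (1 - \<delta>) *\<^sub>R x k"
    \<comment> \<open>Damping replaces \<open>G\<close> by \<open>\<delta> G\<close>; the summand
      \<open>(1 - \<delta>) I\<close> supplies the positive diagonal that (i) assumes of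
      \<open>H\<close>.\<close>
    have W: "mat 1 - (\<delta> *\<^sub>R G) ** A = \<delta> *\<^sub>R H + (1 - \<delta>) *\<^sub>R mat 1"
      and W': "mat 1 - A ** (\<delta> *\<^sub>R G) = \<delta> *\<^sub>R (mat 1 - A ** G) + (1 - \<delta>) *\<^sub>R mat 1"
      by (simp_all add: HG matrix_mul_scaleR algebra_simps)
    have "0 \<le> \<delta> *\<^sub>R G" "0 \<le> mat 1 - (\<delta> *\<^sub>R G) ** A" "0 \<le> mat 1 - A ** (\<delta> *\<^sub>R G)"
      unfolding W W' using \<delta> G0 H0 H'0
      by (auto intro!: add_nonneg_nonneg scaleR_nonneg_nonneg mat_1_nonneg)
    moreover have "invertible (\<delta> *\<^sub>R G)"
    proof -
      obtain G' where "G ** G' = mat 1" "G' ** G = mat 1" using Ginv by (auto simp: invertible_def)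
      with \<delta> show ?thesis
        unfolding invertible_def
        by (intro exI[of _ "inverse \<delta> *\<^sub>R G'"]) (simp add: matrix_mul_scaleR)
    qed
    moreover have "0 < (mat 1 - (\<delta> *\<^sub>R G) ** A) $ i $ i" for i
      unfolding W using \<delta> H0 by (auto simp: mat_def matrix_nonneg_iff intro!: add_nonneg_pos)
    moreover have "x (Suc k) = (mat 1 - (\<delta> *\<^sub>R G) ** A) *v x k + (\<delta> *\<^sub>R G) *v b" for k
      unfolding W using x
      by (simp add: bhat scaleR_matrix_vector_assoc[symmetric] matrix_vector_mult_add_rdistrib algebra_simps)
    ultimately show "\<exists>l. x \<longlonglongrightarrow> l \<and> A *v l = b"
      using affine_iteration_converges[OF assms(2) _ _ _ _ _ z, of "\<delta> *\<^sub>R G" x] by blast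
  qed
qed

end
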